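(* Let $\lambda\in\mathbb{R}\setminus\{0\}$, let $r$ be a nonnegative integer, $p$ a nonnegative integer and $m$ an integer with $m\ge0$. Then for real $x$ with $|x|<1$, \begin{align*} \bigg(x\frac{d}{dx}+r\bigg)_{p,\lambda}\bigg(\frac{1}{1-x}\bigg)^{m+1}&=\sum_{n=0}^{\infty}\binom{n+m}{n}(n+r)_{p,\lambda}x^{n} \\ &=\frac{1}{(1-x)^{m+1}}\sum_{k=0}^{p}{p+r \brace k+r}_{r,\lambda}k!\binom{k+m}{m}\bigg(\frac{x}{1-x}\bigg)^{k}. \end{align*}
   Context: For $\lambda\neq0$, $(x)_{0,\lambda}=1$ and $(x)_{n,\lambda}=x(x-\lambda)\cdots(x-(n-1)\lambda)$ for $n\ge1$; $(x)_k=x(x-1)\cdots(x-k+1)$. The degenerate $r$-Stirling numbers of the second kind are defined by $(x+r)_{n,\lambda}=\sum_{k=0}^{n}{n+r \brace k+r}_{r,\lambda}(x)_{k}$ ($n\ge0$). The degenerate differential operator is $\big(x\frac{d}{dx}+r\big)_{p,\lambda}=\big(x\frac{d}{dx}+r\big)\big(x\frac{d}{dx}+r-\lambda\big)\cdots\big(x\frac{d}{dx}+r-(p-1)\lambda\big)$ for $p\ge1$, and the identity operator for $p=0$. *)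

theory Defs imports "HOL-Analysis.Analysis" begin

definition falling :: "real \<Rightarrow> nat \<Rightarrow> real" where
  "falling x k = (\<Prod>i<k. x - real i)"

definition deg_falling :: "real \<Rightarrow> real \<Rightarrow> nat \<Rightarrow> real" where
  "deg_falling lam x n = (\<Prod>i<n. x - real i * lam)"

text \<open>
  The Stirling numbers are the coefficients of \<open>(x + r)\<^sub>n\<^sub>,\<^sub>\<lambda>\<close> in the
  falling-factorial basis.  \<open>deg_r_stirling2 lam r n k\<close> is the number with upper entry
  \<open>n + r\<close> and lower entry \<open>k + r\<close>; the shift by \<open>r\<close> is not part of the arguments.
  The condition for \<open>k > n\<close> makes the coefficient sequence unique, see
  \<open>deg_r_stirling2_coeffs_ex1\<close>.
\<close>

definition is_deg_r_stirling2_coeffs :: "real \<Rightarrow> nat \<Rightarrow> nat \<Rightarrow> (nat \<Rightarrow> real) \<Rightarrow> bool" where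
  "is_deg_r_stirling2_coeffs lam r n c \<longleftrightarrow>
     (\<forall>k>n. c k = 0) \<and>
     (\<forall>x::real. deg_falling lam (x + real r) n = (\<Sum>k\<le>n. c k * falling x k))"

definition deg_r_stirling2 :: "real \<Rightarrow> nat \<Rightarrow> nat \<Rightarrow> nat \<Rightarrow> real" where
  "deg_r_stirling2 lam r n = (THE c. is_deg_r_stirling2_coeffs lam r n c)"

definition euler_op :: "real \<Rightarrow> (real \<Rightarrow> real) \<Rightarrow> real \<Rightarrow> real" where
  "euler_op a f = (\<lambda>x. x * deriv f x + a * f x)"

text \<open>
  The factor with \<open>r - (p - 1) \<lambda>\<close> is the rightmost one, hence it is applied first.
\<close>

primrec deg_euler_op :: "real \<Rightarrow> real \<Rightarrow> nat \<Rightarrow> (real \<Rightarrow> real) \<Rightarrow> real \<Rightarrow> real" where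
  "deg_euler_op lam a 0 f = f"
| "deg_euler_op lam a (Suc p) f = deg_euler_op lam a p (euler_op (a - real p * lam) f)"

lemma falling_Suc: "falling x (Suc k) = falling x k * (x - real k)"
  by (simp add: falling_def)

lemma falling_nat_eq_0: "j < k \<Longrightarrow> falling (real j) k = 0"
  by (auto simp: falling_def)

lemma falling_nat_self: "falling (real j) j \<noteq> 0"
  by (auto simp: falling_def)

lemma deg_r_stirling2_coeffs_ex: "\<exists>c. is_deg_r_stirling2_coeffs lam r n c"
proof (induction n)
  case 0
  show ?case
    by (rule exI[of _ "\<lambda>k. if k = 0 then 1 else 0"])
       (simp add: is_deg_r_stirling2_coeffs_def deg_falling_def falling_def)
next
  case (Suc n)
  then obtain c where c0: "\<And>k. k > n \<Longrightarrow> c k = 0"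
    and c: "\<And>x. deg_falling lam (x + real r) n = (\<Sum>k\<le>n. c k * falling x k)"
    by (auto simp: is_deg_r_stirling2_coeffs_def)
  define w where "w k = real k + real r - real n * lam" for k
  define d where "d k = (if k = 0 then 0 else c (k - 1)) + w k * c k" for k
  have "deg_falling lam (x + real r) (Suc n) = (\<Sum>k\<le>Suc n. d k * falling x k)" for x
  proof -
    have "deg_falling lam (x + real r) (Suc n) =
            (\<Sum>k\<le>n. c k * falling x k) * (x + real r - real n * lam)"
      by (simp add: c[symmetric]) (simp add: deg_falling_def)
    also have "\<dots> = (\<Sum>k\<le>n. c k * falling x (Suc k) + w k * c k * falling x k)"
      unfolding sum_distrib_right
      by (intro sum.cong refl) (simp add: falling_Suc w_def algebra_simps)
    also have "\<dots> = (\<Sum>k\<le>n. c k * falling x (Suc k)) + (\<Sum>k\<le>Suc n. w k * c k * falling x k)"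
      by (simp add: sum.distrib c0)
    also have "(\<Sum>k\<le>n. c k * falling x (Suc k)) =
                 (\<Sum>k\<le>Suc n. (if k = 0 then 0 else c (k - 1)) * falling x k)"
      by (subst sum.atMost_Suc_shift) simp
    finally show ?thesis
      by (simp only: d_def distrib_right sum.distrib)
  qed
  moreover have "d k = 0" if "k > Suc n" for k
    using that by (simp add: d_def c0)
  ultimately show ?case
    unfolding is_deg_r_stirling2_coeffs_def by blast
qed

lemma deg_r_stirling2_coeffs_unique:
  assumes "is_deg_r_stirling2_coeffs lam r n c" "is_deg_r_stirling2_coeffs lam r n d"
  shows "c = d"
proof
  fix j
  have eq: "(\<Sum>k\<le>n. (c k - d k) * falling x k) = 0" for x
    using assms by (simp add: is_deg_r_stirling2_coeffs_def left_diff_distrib sum_subtractf)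
  show "c j = d j"
  proof (induction j rule: less_induct)
    case (less j)
    show ?case
    proof (cases "j \<le> n")
      case True
      have "(c k - d k) * falling (real j) k = 0" if "k \<noteq> j" for k
        using that less falling_nat_eq_0 by (cases "k < j") auto
      then have "(\<Sum>k\<le>n. (c k - d k) * falling (real j) k) =
                   (\<Sum>k\<in>{j}. (c k - d k) * falling (real j) k)"
        using True by (intro sum.mono_neutral_right) auto
      then show ?thesis
        using eq[of "real j"] falling_nat_self[of j] by simp
    next
      case False
      then show ?thesis
        using assms by (simp add: is_deg_r_stirling2_coeffs_def)
    qed
  qed
qed

lemma deg_r_stirling2_coeffs_ex1: "\<exists>!c. is_deg_r_stirling2_coeffs lam r n c"
  using deg_r_stirling2_coeffs_ex deg_r_stirling2_coeffs_unique by blast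

lemma deg_r_stirling2_expansion:
  "deg_falling lam (x + real r) n = (\<Sum>k\<le>n. deg_r_stirling2 lam r n k * falling x k)"
  using theI'[OF deg_r_stirling2_coeffs_ex1[of lam r n]]
  unfolding deg_r_stirling2_def is_deg_r_stirling2_coeffs_def by blast

end

theory Submission imports Defs begin

text \<open>
  Termwise, \<open>x d/dx + a\<close> multiplies the \<open>n\<close>-th power series coefficient by \<open>n + a\<close>; iterating this
  on the binomial series gives the first identity.  For the second one, expand
  \<open>(n + r)\<^sub>p\<^sub>,\<^sub>\<lambda>\<close> in the falling factorials \<open>(n)\<^sub>k\<close> and use that
  \<open>\<Sum>\<^sub>n (n + m choose n) (n)\<^sub>k x\<^sup>n\<close> is again a shifted binomial series.
\<close>

lemma deg_falling_Suc: "deg_falling lam x (Suc n) = deg_falling lam x n * (x - real n * lam)"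
  by (simp add: deg_falling_def)

lemma euler_op_sums:
  assumes sums: "\<And>t. \<bar>t\<bar> < K \<Longrightarrow> (\<lambda>n. c n * t ^ n) sums f t" and x: "\<bar>x\<bar> < K"
  shows "(\<lambda>n. (real n + a) * c n * x ^ n) sums euler_op a f x"
proof -
  have "((\<lambda>t. \<Sum>n. c n * t ^ n) has_field_derivative (\<Sum>n. diffs c n * x ^ n)) (at x)"
    by (rule termdiffs_strong'[where K = K]) (use sums x in \<open>auto simp: sums_iff\<close>)
  \<comment> \<open>\<open>f\<close> is known to equal its series only on \<open>{-K<..<K}\<close>;
    this set is open and contains \<open>x\<close>, so the derivative carries over.\<close>
  then have deriv: "(f has_field_derivative (\<Sum>n. diffs c n * x ^ n)) (at x)"
    by (rule has_field_derivative_transform_within_open[where S = "{-K<..<K}"])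
       (use sums x in \<open>auto simp: sums_iff abs_less_iff\<close>)
  then have "(\<lambda>n. diffs c n * x ^ n) sums deriv f x"
    using termdiffs_sums_strong[of K c f] sums x by (simp add: DERIV_imp_deriv)
  from sums_mult[OF this, of x]
  have "(\<lambda>n. real (Suc n) * c (Suc n) * x ^ Suc n) sums (x * deriv f x)"
    by (simp add: diffs_def algebra_simps)
  \<comment> \<open>The term at \<open>n = 0\<close> vanishes, so undoing the index shift leaves the
    sum unchanged.\<close>
  then have "(\<lambda>n. real n * c n * x ^ n) sums (x * deriv f x)"
    by (subst (asm) sums_Suc_iff[where f = "\<lambda>n. real n * c n * x ^ n"]) simp
  from sums_add[OF this sums_mult[OF sums[OF x], of a]] show ?thesis
    by (simp add: euler_op_def algebra_simps)
qed

lemma deg_euler_op_sums: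
  assumes "\<And>t. \<bar>t\<bar> < K \<Longrightarrow> (\<lambda>n. c n * t ^ n) sums f t" and "\<bar>x\<bar> < K"
  shows "(\<lambda>n. c n * deg_falling lam (real n + a) p * x ^ n) sums deg_euler_op lam a p f x"
  using assms(1)
\<comment> \<open>The rightmost factor acts first, so the induction hypothesis is needed for
  \<open>euler_op (a - real p * lam) f\<close> and its rescaled coefficients.\<close>
proof (induction p arbitrary: c f)
  case 0
  then show ?case using assms(2) by (simp add: deg_falling_def)
next
  case (Suc p)
  have "(\<lambda>n. (real n + (a - real p * lam)) * c n * t ^ n) sums euler_op (a - real p * lam) f t"
    if "\<bar>t\<bar> < K" for t
    using Suc.prems that by (rule euler_op_sums)
  from Suc.IH[OF this] show ?case
    by (simp add: deg_falling_Suc algebra_simps)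
qed

text \<open>Newton's binomial series with exponent \<open>- real (m + 1)\<close> at
  \<open>- x\<close>; the signs of the generalized binomial coefficients cancel those of
  \<open>(- x) ^ n\<close>.\<close>

lemma negative_binomial_sums:
  fixes x :: real
  assumes "\<bar>x\<bar> < 1"
  shows "(\<lambda>n. real ((n + m) choose n) * x ^ n) sums (1 / (1 - x)) ^ (m + 1)"
proof -
  have "(- real (m + 1) gchoose n) * (- x) ^ n = real ((n + m) choose n) * x ^ n" for n
  proof -
    have "(- real (m + 1) gchoose n) = (- 1) ^ n * real ((n + m) choose n)"
      by (subst gbinomial_minus) (simp add: binomial_gbinomial add.commute)
    moreover have "(- 1) ^ n * (- x) ^ n = x ^ n"
      by (simp flip: power_mult_distrib)
    ultimately show ?thesis by (simp add: mult_ac)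
  qed
  moreover have "(1 - x) powr (- real (m + 1)) = (1 / (1 - x)) ^ (m + 1)"
    using assms by (simp only: powr_minus powr_realpow) (simp add: power_one_over inverse_eq_divide)
  ultimately show ?thesis
    using gen_binomial_real[of "- x" "- real (m + 1)"] assms by simp
qed

lemma falling_nat_fact: "falling (real (i + k)) k * fact i = fact (i + k)"
proof (induction k arbitrary: i)
  case 0
  then show ?case by (simp add: falling_def)
next
  case (Suc k)
  \<comment> \<open>The last factor of the falling factorial is \<open>i + 1\<close>, which turns
    \<open>fact i\<close> into \<open>fact (Suc i)\<close>; hence \<open>i\<close> varies in the
    induction.\<close>
  have "falling (real (i + Suc k)) (Suc k) * fact i
      = falling (real (Suc i + k)) k * fact (Suc i)"
    by (simp add: falling_Suc)
  then show ?case using Suc.IH[of "Suc i"] by simp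
qed

text \<open>Both sides equal \<open>fact (i + k + m) / (fact i * fact m)\<close>. On the right, the
  only factor depending on \<open>i\<close> is a coefficient of the binomial series with
  \<open>k + m\<close> in place of \<open>m\<close>.\<close>

lemma choose_falling:
  "real ((i + k + m) choose (i + k)) * falling (real (i + k)) k
     = fact k * real ((k + m) choose m) * real ((i + (k + m)) choose i)"
proof -
  have "real ((i + k + m) choose (i + k)) = fact (i + k + m) / (fact (i + k) * fact m)"
    "real ((k + m) choose m) = fact (k + m) / (fact m * fact k)"
    "real ((i + (k + m)) choose i) = fact (i + (k + m)) / (fact i * fact (k + m))"
    by (simp_all add: binomial_fact)
  moreover have "falling (real (i + k)) k = fact (i + k) / fact i"
    using falling_nat_fact[of i k] by (simp add: field_simps)
  ultimately show ?thesis by (simp only:) (simp add: field_simps)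
qed

lemma binomial_falling_sums:
  fixes x :: real
  assumes "\<bar>x\<bar> < 1"
  shows "(\<lambda>n. real ((n + m) choose n) * falling (real n) k * x ^ n)
           sums (1 / (1 - x) ^ (m + 1) * (fact k * real ((k + m) choose m) * (x / (1 - x)) ^ k))"
    (is "?f sums ?s")
proof -
  have "(\<lambda>i. fact k * real ((k + m) choose m) * x ^ k * (real ((i + (k + m)) choose i) * x ^ i))
          sums (fact k * real ((k + m) choose m) * x ^ k * (1 / (1 - x)) ^ (k + m + 1))"
    by (intro sums_mult negative_binomial_sums assms)
  moreover have "?f (i + k)
      = fact k * real ((k + m) choose m) * x ^ k * (real ((i + (k + m)) choose i) * x ^ i)" for i
    unfolding choose_falling by (simp add: power_add)
  moreover have "fact k * real ((k + m) choose m) * x ^ k * (1 / (1 - x)) ^ (k + m + 1) = ?s"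
    by (simp add: power_add power_divide)
  ultimately have "(\<lambda>i. ?f (i + k)) sums ?s" by (simp only:)
  \<comment> \<open>\<open>falling (real i) k\<close> vanishes for \<open>i < k\<close>, so starting
    the series at index \<open>k\<close> loses nothing.\<close>
  moreover have "(\<Sum>i<k. ?f i) = 0"
    by (simp add: falling_nat_eq_0)
  ultimately show ?thesis
    by (subst (asm) sums_iff_shift) simp
qed

theorem theorem9:
  fixes lam x :: real and r p m :: nat
  assumes "lam \<noteq> 0" and "\<bar>x\<bar> < 1"
  shows "(\<lambda>n. real ((n + m) choose n) * deg_falling lam (real n + real r) p * x ^ n)
           sums deg_euler_op lam (real r) p (\<lambda>t. (1 / (1 - t)) ^ (m + 1)) x
       \<and> (\<Sum>n. real ((n + m) choose n) * deg_falling lam (real n + real r) p * x ^ n)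
           = 1 / (1 - x) ^ (m + 1) *
             (\<Sum>k = 0..p. deg_r_stirling2 lam r p k * fact k * real ((k + m) choose m)
                          * (x / (1 - x)) ^ k)"
proof
  show "(\<lambda>n. real ((n + m) choose n) * deg_falling lam (real n + real r) p * x ^ n)
           sums deg_euler_op lam (real r) p (\<lambda>t. (1 / (1 - t)) ^ (m + 1)) x"
    using negative_binomial_sums assms(2) by (rule deg_euler_op_sums)
  \<comment> \<open>The sum over \<open>k\<close> is finite, so it may be exchanged with the series
    in \<open>n\<close>; the inner sum is then the Stirling expansion of
    \<open>deg_falling lam (real n + real r) p\<close>.\<close>
  have "(\<lambda>n. \<Sum>k\<le>p. deg_r_stirling2 lam r p k *
            (real ((n + m) choose n) * falling (real n) k * x ^ n))
        sums (\<Sum>k\<le>p. deg_r_stirling2 lam r p k *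
            (1 / (1 - x) ^ (m + 1) * (fact k * real ((k + m) choose m) * (x / (1 - x)) ^ k)))"
    by (intro sums_sum sums_mult binomial_falling_sums assms(2))
  then show "(\<Sum>n. real ((n + m) choose n) * deg_falling lam (real n + real r) p * x ^ n)
           = 1 / (1 - x) ^ (m + 1) *
             (\<Sum>k = 0..p. deg_r_stirling2 lam r p k * fact k * real ((k + m) choose m)
                          * (x / (1 - x)) ^ k)"
    by (simp add: sums_iff deg_r_stirling2_expansion sum_distrib_left sum_distrib_right
        atMost_atLeast0 mult_ac)
qed

end
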